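(* Let $p$ be a prime and let $r,s$ be integers with $1\leq r\leq s$. Suppose that $s\not\equiv 0,\pm1,\pm2,\dots,\pm(r-2)\pmod p$. Then $\lambda(r,s,p)$ is the standard partition, i.e. its $i$th part is $\lambda_i=r+s+1-2i$ for $1\leq i\leq r$.
   Context: For a positive integer $n$, let $J_n$ denote the $n\times n$ matrix with $1$s in positions $(i,i)$ for $1\le i\le n$ and $(i,i+1)$ for $1\le i<n$, and $0$s elsewhere (a unipotent Jordan block). For $1\le r\le s$ and a field $F$ of characteristic $p$, the Jordan canonical form of the $rs\times rs$ matrix $J_r\otimes J_s$ over $F$ is $J_{\lambda_1}\oplus\cdots\oplus J_{\lambda_r}$ with $\lambda_1\ge\cdots\ge\lambda_r>0$ and $\sum_i\lambda_i=rs$; this partition $\lambda(r,s,p)=(\lambda_1,\dots,\lambda_r)$ of $rs$ depends only on $r,s,p$. The standard partition of $rs$ is $(s+r-1,s+r-3,\dots,s-r+1)$. *)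

theory Defs
  imports "Jordan_Normal_Form.Jordan_Normal_Form" "HOL-Number_Theory.Cong"
begin

definition kronecker_mat :: "'a :: times mat \<Rightarrow> 'a mat \<Rightarrow> 'a mat" where
  "kronecker_mat A B = mat (dim_row A * dim_row B) (dim_col A * dim_col B)
     (\<lambda>(i,j). A $$ (i div dim_row B, j div dim_col B) * B $$ (i mod dim_row B, j mod dim_col B))"

definition unip_jordan :: "nat \<Rightarrow> 'a :: {zero,one} mat" where
  "unip_jordan n = jordan_block n 1"

end

theory Submission
  imports Defs
begin

text \<open>
  The Kronecker product acts on \<open>F[x, y]/(x\<^sup>r, y\<^sup>s)\<close> as multiplication by \<open>(1 + x)(1 + y)\<close>, and the
  substitution \<open>y \<mapsto> (1 + x) y\<close> reduces its nilpotent part to multiplication by \<open>x + y\<close>, which is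
  homogeneous. For \<open>d < r\<close>, a dimension count gives a nonzero form \<open>f\<^sub>d\<close> of degree \<open>d\<close> with
  \<open>(x + y)\<^bsup>r+s-1-2d\<^esup> f\<^sub>d = 0\<close>. If already \<open>(x + y)\<^bsup>r+s-2-2d\<^esup> f\<^sub>d = 0\<close>, then setting \<open>y = 1\<close> gives a
  Pade approximation of \<open>(1 + x)\<^bsup>r+s-2-2d\<^esup>\<close> that is too good, and a Wronskian argument shows that
  \<open>s\<close> is congruent to some \<open>t\<close> with \<open>\<bar>t\<bar> \<le> r - 2\<close>. So the chain of \<open>f\<^sub>d\<close> has length exactly
  \<open>r + s - 1 - 2d\<close>. The last vectors of these chains live in distinct degrees, so the chains are
  jointly independent, and their total length is \<open>r s\<close>.
\<close>

section \<open>Polynomials with gaps\<close>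

text \<open>The gap amounts to \<open>d\<close> homogeneous linear equations in the
  \<open>d + 1\<close> coefficients of \<open>f\<close>, so a nonzero solution exists.\<close>

lemma nonzero_poly_with_coeff_gap:
  fixes g :: "'a :: field poly"
  shows "\<exists>f. f \<noteq> 0 \<and> degree f \<le> d \<and> (\<forall>k. a < k \<and> k \<le> a + d \<longrightarrow> coeff (g * f) k = 0)"
proof -
  \<comment> \<open>Row \<open>i < d\<close> computes the coefficient of \<open>g * f\<close> at
    \<open>a + 1 + i\<close>; the zero row makes the matrix square and singular.\<close>
  define M where "M = mat\<^sub>r (Suc d) (Suc d) (\<lambda>i. if i = d then 0\<^sub>v (Suc d)
    else vec (Suc d) (\<lambda>j. if j \<le> a + 1 + i then coeff g (a + 1 + i - j) else 0))"
  have M: "M \<in> carrier_mat (Suc d) (Suc d)" unfolding M_def by simp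
  have "det M = 0" unfolding M_def by (rule det_row_0) auto
  then obtain v where v: "v \<in> carrier_vec (Suc d)" "v \<noteq> 0\<^sub>v (Suc d)" "M *\<^sub>v v = 0\<^sub>v (Suc d)"
    using det_0_iff_vec_prod_zero_field[OF M] by blast
  define f where "f = (\<Sum>j<Suc d. monom (v $ j) j)"
  have cf: "coeff f j = (if j < Suc d then v $ j else 0)" for j
    unfolding f_def by (simp add: coeff_sum if_distrib sum.delta del: sum.lessThan_Suc)
  have "f \<noteq> 0"
  proof
    assume "f = 0"
    then have "v $ j = 0" if "j < Suc d" for j using cf[of j] that by simp
    then have "v = 0\<^sub>v (Suc d)" using v(1) by (intro eq_vecI) auto
    with v(2) show False by simp
  qed
  moreover have "degree f \<le> d" by (rule degree_le) (auto simp: cf)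
  moreover have "coeff (g * f) k = 0" if k: "a < k" "k \<le> a + d" for k
  proof -
    define i where "i = k - a - 1"
    have i: "i < d" "k = a + 1 + i" using k by (auto simp: i_def)
    have "coeff (g * f) k = (\<Sum>j\<le>k. coeff f j * coeff g (k - j))"
      by (subst mult.commute) (simp add: coeff_mult)
    also have "\<dots> = (\<Sum>j\<in>{..<Suc d}. if j \<le> k then coeff f j * coeff g (k - j) else 0)"
      unfolding sum.If_cases[OF finite_lessThan]
      by (simp, rule sum.mono_neutral_right) (auto simp: cf)
    also have "\<dots> = (\<Sum>j = 0..<Suc d. M $$ (i, j) * v $ j)"
      unfolding lessThan_atLeast0
      by (rule sum.cong) (use i in \<open>auto simp: cf M_def\<close>)
    also have "\<dots> = (M *\<^sub>v v) $ i"
      using i v(1) M by (auto simp: scalar_prod_def intro!: sum.cong)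
    also have "\<dots> = 0" using v(3) i by simp
    finally show ?thesis .
  qed
  ultimately show ?thesis by blast
qed

text \<open>Powers of \<open>1 + X\<close> have constant term 1, hence order 0 at 0, and can be
  cancelled.\<close>

lemma monom_dvd_shift_cancel:
  fixes w :: "'a :: field poly"
  assumes "monom 1 n dvd [:1, 1:] ^ h * w"
  shows "monom 1 n dvd w"
proof (cases "w = 0")
  case False
  let ?u = "[:1, 1:] ^ h :: 'a poly"
  have X: "monom 1 n = [:- 0, 1 :: 'a:] ^ n" by (simp add: monom_altdef)
  have u: "poly ?u 0 \<noteq> 0" "?u \<noteq> 0" by auto
  have "order 0 (?u * w) = order 0 ?u + order 0 w"
    using u False by (intro order_mult) simp
  moreover have "order 0 ?u = 0" using u(1) by (rule order_0I)
  ultimately show ?thesis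
    using assms u False unfolding X order_divides by auto
qed auto

text \<open>If a degree lies strictly below its bound, both sides are 0. Bounds suit derivatives,
  whose exact degree depends on the characteristic.\<close>

lemma coeff_mult_at_degree_bounds:
  fixes p q :: "'a :: idom poly"
  assumes "degree p \<le> m" "degree q \<le> n"
  shows "coeff (p * q) (m + n) = coeff p m * coeff q n"
proof (cases "degree p = m \<and> degree q = n")
  case True
  then show ?thesis using coeff_mult_degree_sum[of p q] by simp
next
  case False
  then have "degree p + degree q < m + n" using assms by auto
  moreover have "coeff p m * coeff q n = 0"
    using False assms by (metis coeff_eq_0 le_neq_implies_less mult_eq_0_iff)
  ultimately show ?thesis by (metis coeff_eq_0 degree_mult_le le_less_trans)
qed

text \<open>
  If \<open>(1 + X)\<^sup>h f = q + O(X\<^bsup>m+d+2\<^esup>)\<close> with \<open>deg q \<le> m\<close>, then the Wronskian-type polynomial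
  \<open>W = h f q + (1 + X)(f' q - f q')\<close> is divisible by \<open>X\<^bsup>m+d+1\<^esup>\<close>. In particular its coefficient
  in degree \<open>deg f + deg q\<close>, which is \<open>h + deg f - deg q\<close> times a nonzero scalar, vanishes.
\<close>
lemma coeff_gap_imp_char_relation:
  fixes f :: "'a :: field poly"
  assumes f: "f \<noteq> 0" "degree f \<le> d"
    and gap: "\<And>k. m < k \<Longrightarrow> k \<le> m + d + 1 \<Longrightarrow> coeff ([:1, 1:] ^ h * f) k = 0"
  shows "\<exists>a b. a \<le> m \<and> b \<le> d \<and> (of_nat (h + b) :: 'a) = of_nat a"
proof -
  let ?u = "[:1, 1:] :: 'a poly"
  define g where "g = ?u ^ h * f"
  define q where "q = poly_cutoff (Suc m) g"
  have dq: "degree q \<le> m" by (rule degree_le) (auto simp: q_def coeff_poly_cutoff)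
  have "monom 1 (m + d + 2) dvd g - q"
    unfolding monom_1_dvd_iff' using gap by (auto simp: q_def coeff_poly_cutoff g_def)
  then obtain G where "g - q = monom 1 (m + d + 2) * G" by (elim dvdE)
  then have g: "g = q + monom 1 (m + d + 2) * G" by (simp add: algebra_simps)
  have q0: "q \<noteq> 0"
  proof
    assume "q = 0"
    then have "monom 1 (m + d + 2) dvd ?u ^ h * f" using g by (simp add: g_def)
    then have "monom 1 (m + d + 2) dvd f" by (rule monom_dvd_shift_cancel)
    then show False using f dvd_imp_degree_le[of "monom (1::'a) (m + d + 2)" f]
      by (simp add: degree_monom_eq)
  qed
  define W where "W = of_nat h * (f * q) + ?u * (pderiv f * q - f * pderiv q)"
  have "?u * pderiv g = of_nat h * g + ?u ^ h * ?u * pderiv f"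
  proof (cases h)
    case (Suc h')
    have "pderiv (?u ^ h) = of_nat h * ?u ^ h'"
      unfolding Suc pderiv_power_Suc by (simp add: pderiv_pCons of_nat_poly)
    then show ?thesis unfolding g_def pderiv_mult by (simp add: Suc algebra_simps)
  qed (simp add: g_def)
  then have "?u ^ h * W = ?u * (q * pderiv g - g * pderiv q)"
    by (simp add: W_def g_def algebra_simps)
  \<comment> \<open>On inserting \<open>g = q + X^(m+d+2) G\<close>, the products of
    \<open>q\<close> and \<open>pderiv q\<close> cancel, and differentiating
    \<open>X^(m+d+2)\<close> costs only one power of \<open>X\<close>.\<close>
  also have "q * pderiv g - g * pderiv q =
      monom 1 (m + d + 1) * (q * (of_nat (m + d + 2) * G + monom 1 1 * pderiv G)
        - monom 1 1 * G * pderiv q)"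
  proof -
    have 1: "monom 1 (m + d + 2) = monom 1 (m + d + 1) * monom (1::'a) 1"
      by (simp add: mult_monom)
    have 2: "pderiv (monom 1 (m + d + 2)) = monom (1::'a) (m + d + 1) * of_nat (m + d + 2)"
      by (simp add: pderiv_monom of_nat_poly mult_monom flip: monom_0)
    have 3: "q * (q' + (M * X * G' + G * (M * N))) - (q + M * X * G) * q' =
        M * (q * (N * G + X * G') - X * G * q')" for q q' M X G G' N :: "'a poly"
      by (simp add: algebra_simps)
    show ?thesis unfolding g pderiv_add pderiv_mult 2 unfolding 1 by (rule 3)
  qed
  finally have "monom 1 (m + d + 1) dvd ?u ^ h * W"
    by (metis dvd_mult dvd_triv_left)
  then have dvd: "monom 1 (m + d + 1) dvd W" by (rule monom_dvd_shift_cancel)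
  let ?b = "degree f" and ?a = "degree q"
  have "coeff W (?b + ?a) = 0" using dvd f(2) dq unfolding monom_1_dvd_iff' by simp
  moreover have "coeff W (?b + ?a) =
    (of_nat h + of_nat ?b - of_nat ?a) * (coeff f ?b * coeff q ?a)"
  proof -
    \<comment> \<open>In top degree only the summand \<open>X\<close> of \<open>1 + X\<close>
      counts: \<open>X * pderiv x\<close> multiplies the leading coefficient of \<open>x\<close> by
      its degree, while \<open>pderiv x\<close> contributes 0.\<close>
    have split: "?u * x = x + pCons 0 x" for x :: "'a poly" by simp
    have cp: "coeff (pderiv x) (degree x) = 0" for x :: "'a poly"
      by (simp add: coeff_pderiv coeff_eq_0)
    have ce: "coeff (pCons 0 (pderiv x)) (degree x) = of_nat (degree x) * coeff x (degree x)"
      for x :: "'a poly" by (cases "degree x") (simp_all add: coeff_pderiv)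
    have dp: "degree (pderiv x) \<le> degree x" for x :: "'a poly"
      by (rule degree_le) (simp add: coeff_pderiv coeff_eq_0)
    have de: "degree (pCons 0 (pderiv x)) \<le> degree x" for x :: "'a poly"
      by (rule degree_le) (auto simp: coeff_pCons coeff_pderiv coeff_eq_0 split: nat.split)
    have "W = of_nat h * (f * q) + (pderiv f * q - f * pderiv q)
        + (pCons 0 (pderiv f) * q - f * pCons 0 (pderiv q))"
      by (simp add: W_def split)
    moreover have "coeff (of_nat h * (f * q)) (?b + ?a) = of_nat h * (coeff f ?b * coeff q ?a)"
      by (simp add: of_nat_poly coeff_mult_degree_sum)
    moreover have "coeff (pderiv f * q) (?b + ?a) = 0" "coeff (f * pderiv q) (?b + ?a) = 0"
      using dp by (simp_all add: coeff_mult_at_degree_bounds cp)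
    moreover have "coeff (pCons 0 (pderiv f) * q) (?b + ?a) = of_nat ?b * coeff f ?b * coeff q ?a"
      by (subst coeff_mult_at_degree_bounds[OF de order_refl], subst ce) (rule refl)
    moreover have "coeff (f * pCons 0 (pderiv q)) (?b + ?a) = coeff f ?b * (of_nat ?a * coeff q ?a)"
      by (subst coeff_mult_at_degree_bounds[OF order_refl de], subst ce) (rule refl)
    ultimately show ?thesis
      by (simp only: coeff_add coeff_diff) (simp add: algebra_simps)
  qed
  ultimately have "(of_nat (h + ?b) :: 'a) = of_nat ?a" using f(1) q0 by simp
  then show ?thesis using f(2) dq by blast
qed

section \<open>Jordan normal forms from chains\<close>

lemma sum_lessThan_add:
  fixes g :: "nat \<Rightarrow> 'a :: comm_monoid_add"
  shows "(\<Sum>j<a + b. g j) = (\<Sum>j<a. g j) + (\<Sum>q<b. g (a + q))"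
  by (induction b) (simp_all add: add.assoc)

lemma sum_lessThan_sum:
  fixes g :: "nat \<Rightarrow> 'a :: comm_monoid_add" and l :: "nat \<Rightarrow> nat"
  shows "(\<Sum>j<(\<Sum>d<m. l d). g j) = (\<Sum>d<m. \<Sum>q<l d. g ((\<Sum>e<d. l e) + q))"
  by (induction m) (simp_all add: sum_lessThan_add)

lemma less_sum_lessThanE:
  fixes l :: "nat \<Rightarrow> nat"
  assumes "j < (\<Sum>d<m. l d)"
  obtains d q where "d < m" "q < l d" "j = (\<Sum>e<d. l e) + q"
  using assms
proof (induction m arbitrary: thesis)
  case (Suc m)
  show ?case
  proof (cases "j < (\<Sum>d<m. l d)")
    case True
    then show ?thesis using Suc.IH Suc.prems(1) less_SucI by metis
  next
    case False
    then show ?thesis using Suc.prems(2)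
      by (intro Suc.prems(1)[of m "j - (\<Sum>d<m. l d)"]) auto
  qed
qed simp

lemma length_concat_map_upt:
  assumes "\<And>d. length (f d) = l d"
  shows "length (concat (map f [0..<m])) = (\<Sum>d<m. l d)"
  by (induction m) (simp_all add: assms)

lemma nth_concat_map_upt:
  assumes len: "\<And>d. length (f d) = l d" and "d < m" "q < l d"
  shows "concat (map f [0..<m]) ! ((\<Sum>e<d. l e) + q) = f d ! q"
  using \<open>d < m\<close>
proof (induction m)
  case (Suc m)
  show ?case
  proof (cases "d = m")
    case True
    then show ?thesis by (simp add: nth_append length_concat_map_upt[OF len] del: length_concat)
  next
    case False
    then have "d < m" using Suc.prems by simp
    have "(\<Sum>e<d. l e) + q < (\<Sum>e<Suc d. l e)" using \<open>q < l d\<close> by simp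
    also have "\<dots> \<le> (\<Sum>e<m. l e)" using \<open>d < m\<close> by (intro sum_mono2) auto
    finally show ?thesis using Suc.IH[OF \<open>d < m\<close>]
      by (simp add: nth_append length_concat_map_upt[OF len] del: length_concat)
  qed
qed simp

text \<open>Lower blocks without rows turn horizontal concatenation into a block matrix, so that
  block multiplication applies.\<close>

lemma mat_of_cols_append:
  "mat_of_cols n (xs @ ys) = four_block_mat (mat_of_cols n xs) (mat_of_cols n ys)
     (0\<^sub>m 0 (length xs)) (0\<^sub>m 0 (length ys))"
  by (rule eq_matI) (auto simp: mat_of_cols_def nth_append)

lemma mat_of_cols_concat_jordan_matrix:
  fixes A :: "'a :: comm_ring_1 mat"
  assumes A: "A \<in> carrier_mat n n"
    and L: "\<And>c. c \<in> set L \<Longrightarrow> A * mat_of_cols n c = mat_of_cols n c * jordan_block (length c) a"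
  shows "A * mat_of_cols n (concat L) =
    mat_of_cols n (concat L) * jordan_matrix (map (\<lambda>c. (length c, a)) L)"
  using L
proof (induction L)
  case Nil
  then show ?case using A by (intro eq_matI) (auto simp: jordan_matrix_def)
next
  case (Cons c L)
  let ?J = "jordan_matrix (map (\<lambda>c. (length c, a)) L)"
  let ?l = "length c" and ?k = "length (concat L)"
  have J: "?J \<in> carrier_mat ?k ?k"
    using jordan_matrix_carrier[of "map (\<lambda>c. (length c, a)) L"] by (simp add: length_concat comp_def)
  have JC: "jordan_matrix (map (\<lambda>c. (length c, a)) (c # L)) =
      four_block_mat (jordan_block ?l a) (0\<^sub>m ?l ?k) (0\<^sub>m ?k ?l) ?J"
    using J unfolding jordan_matrix_def by (simp add: Let_def del: length_concat)
  have AB: "A = four_block_mat A (0\<^sub>m n 0) (0\<^sub>m 0 n) (0\<^sub>m 0 0)"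
    using A by (intro eq_matI) auto
  have P: "mat_of_cols n (concat (c # L)) = four_block_mat (mat_of_cols n c)
     (mat_of_cols n (concat L)) (0\<^sub>m 0 ?l) (0\<^sub>m 0 ?k)"
    by (simp add: mat_of_cols_append del: length_concat)
  have c1: "mat_of_cols n c \<in> carrier_mat n ?l" "mat_of_cols n (concat L) \<in> carrier_mat n ?k"
    "jordan_block ?l a \<in> carrier_mat ?l ?l" by (auto simp del: length_concat)
  have "A * mat_of_cols n (concat (c # L)) = four_block_mat
     (A * mat_of_cols n c) (A * mat_of_cols n (concat L)) (0\<^sub>m 0 ?l) (0\<^sub>m 0 ?k)"
    unfolding P by (subst AB, subst mult_four_block_mat[OF A _ _ _ c1(1,2)])
      (use A c1 in \<open>auto simp del: length_concat\<close>)
  also have "\<dots> = four_block_mat (mat_of_cols n c * jordan_block ?l a)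
     (mat_of_cols n (concat L) * ?J) (0\<^sub>m 0 ?l) (0\<^sub>m 0 ?k)"
    using Cons by simp
  also have "\<dots> = mat_of_cols n (concat (c # L)) * jordan_matrix (map (\<lambda>c. (length c, a)) (c # L))"
    unfolding P JC
    by (subst mult_four_block_mat[OF c1(1,2) _ _ c1(3) _ _ J])
      (use c1 J mult_carrier_mat[OF c1(1,3)] mult_carrier_mat[OF c1(2) J]
        mult_carrier_mat[OF zero_carrier_mat J] in \<open>auto simp del: length_concat\<close>)
  finally show ?case .
qed

text \<open>The ones of \<open>jordan_block\<close> lie above the diagonal, so the chain is listed
  backwards: \<open>A\<close> sends a column to \<open>a\<close> times itself plus the preceding
  column. The first column has no predecessor, which is consistent because \<open>w l\<close> is
  zero.\<close>

lemma mat_of_cols_chain_jordan_block: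
  fixes A :: "'a :: comm_ring_1 mat"
  assumes A: "A \<in> carrier_mat n n"
    and w: "\<And>k. w k \<in> carrier_vec n"
    and step: "\<And>k. A *\<^sub>v w k = a \<cdot>\<^sub>v w k + w (Suc k)"
    and zero: "w l = 0\<^sub>v n"
  shows "A * mat_of_cols n (map (\<lambda>q. w (l - 1 - q)) [0..<l]) =
    mat_of_cols n (map (\<lambda>q. w (l - 1 - q)) [0..<l]) * jordan_block l a" (is "A * ?P = ?P * ?J")
proof (rule eq_matI)
  fix i j assume "i < dim_row (?P * ?J)" "j < dim_col (?P * ?J)"
  then have i: "i < n" and j: "j < l" by auto
  have wd: "dim_vec (w k) = n" for k using w[of k] by auto
  have P: "?P $$ (i, q) = w (l - 1 - q) $ i" if "q < l" for q
    using that i by (simp add: mat_of_cols_index)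
  have "(A * ?P) $$ (i, j) = (A *\<^sub>v w (l - 1 - j)) $ i"
    using i j A w by simp
  also have "\<dots> = a * w (l - 1 - j) $ i + w (l - j) $ i"
    using i j wd by (simp add: step Suc_diff_Suc)
  also have "w (l - j) $ i = (if j = 0 then 0 else w (l - 1 - (j - 1)) $ i)"
    using i zero by auto
  also have "a * w (l - 1 - j) $ i + \<dots> = (\<Sum>q<l. ?P $$ (i, q) * (if q = j then a else 0))
      + (\<Sum>q<l. ?P $$ (i, q) * (if Suc q = j then 1 else 0))"
  proof -
    have "(\<Sum>q<l. ?P $$ (i, q) * (if q = j then a else 0)) = a * w (l - 1 - j) $ i"
      using j P[OF j] by (simp add: if_distrib[of "(*) _"] sum.delta mult.commute[of a] cong: if_cong)
    moreover have "(\<Sum>q<l. ?P $$ (i, q) * (if Suc q = j then 1 else 0)) =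
        (if j = 0 then 0 else w (l - 1 - (j - 1)) $ i)"
    proof (cases j)
      case (Suc j')
      then show ?thesis
        using j P[of j'] by (simp add: if_distrib[of "(*) _"] sum.delta cong: if_cong)
    qed simp
    ultimately show ?thesis by simp
  qed
  also have "\<dots> = (\<Sum>q<l. ?P $$ (i, q) * ?J $$ (q, j))"
    unfolding sum.distrib[symmetric] using j by (intro sum.cong) auto
  also have "\<dots> = (?P * ?J) $$ (i, j)"
    using i j by (simp add: scalar_prod_def lessThan_atLeast0)
  finally show "(A * ?P) $$ (i, j) = (?P * ?J) $$ (i, j)" .
qed (use A in auto)

text \<open>The linear map \<open>A - a\<close> sends \<open>w x\<close> to \<open>w' x\<close>, so
  it carries a relation over with the same coefficients.\<close>

lemma chain_step_shift:
  fixes A :: "'a :: comm_ring_1 mat"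
  assumes A: "A \<in> carrier_mat n n"
    and w: "\<And>x. x \<in> X \<Longrightarrow> w x \<in> carrier_vec n"
    and w': "\<And>x. x \<in> X \<Longrightarrow> w' x \<in> carrier_vec n"
    and step: "\<And>x. x \<in> X \<Longrightarrow> A *\<^sub>v w x = a \<cdot>\<^sub>v w x + w' x"
    and zero: "\<And>i. i < n \<Longrightarrow> (\<Sum>x\<in>X. c x * w x $ i) = 0"
    and i: "i < n"
  shows "(\<Sum>x\<in>X. c x * w' x $ i) = 0"
proof -
  have "w' x $ i = (\<Sum>j<n. A $$ (i, j) * w x $ j) - a * w x $ i" if "x \<in> X" for x
  proof -
    have "(A *\<^sub>v w x) $ i = a * w x $ i + w' x $ i"
      using step[OF that] w[OF that] w'[OF that] i by simp
    moreover have "(A *\<^sub>v w x) $ i = (\<Sum>j<n. A $$ (i, j) * w x $ j)"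
      using A w[OF that] i by (auto simp: scalar_prod_def lessThan_atLeast0 intro!: sum.cong)
    ultimately show ?thesis by simp
  qed
  then have "(\<Sum>x\<in>X. c x * w' x $ i) =
      (\<Sum>x\<in>X. \<Sum>j<n. A $$ (i, j) * (c x * w x $ j)) - (\<Sum>x\<in>X. a * (c x * w x $ i))"
    by (simp add: sum_subtractf[symmetric] right_diff_distrib sum_distrib_left mult_ac)
  also have "\<dots> = (\<Sum>j<n. A $$ (i, j) * (\<Sum>x\<in>X. c x * w x $ j)) - a * (\<Sum>x\<in>X. c x * w x $ i)"
    by (subst sum.swap) (simp add: sum_distrib_left)
  also have "\<dots> = 0" using zero i by simp
  finally show ?thesis .
qed

text \<open>
  In a nontrivial relation, applying a power of \<open>A - a\<close> that is as large as possible without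
  killing all terms leaves a nontrivial relation between the last vectors of the chains.
\<close>
lemma chain_combination_trivial:
  fixes A :: "'a :: comm_ring_1 mat" and v :: "nat \<Rightarrow> nat \<Rightarrow> 'a vec" and l :: "nat \<Rightarrow> nat"
  assumes A: "A \<in> carrier_mat n n"
    and v: "\<And>d k. d < m \<Longrightarrow> v d k \<in> carrier_vec n"
    and step: "\<And>d k. d < m \<Longrightarrow> A *\<^sub>v v d k = a \<cdot>\<^sub>v v d k + v d (Suc k)"
    and zero: "\<And>d k. d < m \<Longrightarrow> l d \<le> k \<Longrightarrow> v d k = 0\<^sub>v n"
    and indep: "\<And>c. (\<And>i. i < n \<Longrightarrow> (\<Sum>d<m. c d * v d (l d - 1) $ i) = 0) \<Longrightarrow> \<forall>d<m. c d = 0"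
    and comb: "\<And>i. i < n \<Longrightarrow> (\<Sum>d<m. \<Sum>q<l d. c d q * v d (l d - 1 - q) $ i) = 0"
    and d: "d < m" "q < l d"
  shows "c d q = 0"
proof (rule ccontr)
  assume "c d q \<noteq> 0"
  \<comment> \<open>The offset \<open>q\<close> counts back from the end of a chain;
    \<open>Q\<close> will be the largest offset carrying a nonzero coefficient.\<close>
  define S where "S = {q. \<exists>d<m. q < l d \<and> c d q \<noteq> 0}"
  have "S \<subseteq> (\<Union>d<m. {..<l d})" by (auto simp: S_def)
  then have finS: "finite S" by (rule finite_subset) auto
  have "S \<noteq> {}" using d \<open>c d q \<noteq> 0\<close> by (auto simp: S_def)
  define Q where "Q = Max S"
  have "Q \<in> S" using finS \<open>S \<noteq> {}\<close> by (simp add: Q_def)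
  then obtain D where D: "D < m" "Q < l D" "c D Q \<noteq> 0" by (auto simp: S_def)
  have above: "c d q = 0" if "d < m" "q < l d" "Q < q" for d q
  proof (rule ccontr)
    assume "c d q \<noteq> 0"
    then have "q \<in> S" using that by (auto simp: S_def)
    then show False using Max_ge[OF finS] \<open>Q < q\<close> by (force simp: Q_def)
  qed
  let ?X = "Sigma {..<m} (\<lambda>d. {..<l d})"
  have shifted: "(\<Sum>x\<in>?X. c (fst x) (snd x) * v (fst x) (l (fst x) - 1 - snd x + t) $ i) = 0"
    if "i < n" for t i
    using that
  proof (induction t arbitrary: i)
    case 0
    then show ?case using comb[of i] by (simp add: sum.Sigma split_def)
  next
    case (Suc t)
    show ?case
      by (rule chain_step_shift[OF A, where w = "\<lambda>x. v (fst x) (l (fst x) - 1 - snd x + t)"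
            and a = a]) (use Suc v step in auto)
  qed
  have "(\<Sum>d<m. (if Q < l d then c d Q else 0) * v d (l d - 1) $ i) = 0" if i: "i < n" for i
  proof -
    \<comment> \<open>After \<open>Q\<close> applications of \<open>A - a\<close>, terms with
      \<open>q < Q\<close> have run past the end of their chain and terms with \<open>q > Q\<close>
      have coefficient 0, so only last vectors remain.\<close>
    have "(\<Sum>q<l d. c d q * v d (l d - 1 - q + Q) $ i) =
        (if Q < l d then c d Q else 0) * v d (l d - 1) $ i" if "d < m" for d
    proof -
      have "c d q * v d (l d - 1 - q + Q) $ i =
          (if q = Q then (if Q < l d then c d Q else 0) * v d (l d - 1) $ i else 0)"
        if "q < l d" for q
        using above[OF \<open>d < m\<close> that] zero[OF \<open>d < m\<close>, of "l d - 1 - q + Q"] i that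
        by (cases q Q rule: linorder_cases) auto
      then have "(\<Sum>q<l d. c d q * v d (l d - 1 - q + Q) $ i) =
          (\<Sum>q<l d. if q = Q then (if Q < l d then c d Q else 0) * v d (l d - 1) $ i else 0)"
        by (intro sum.cong) auto
      then show ?thesis by (simp add: sum.delta)
    qed
    then have "(\<Sum>d<m. (if Q < l d then c d Q else 0) * v d (l d - 1) $ i) =
        (\<Sum>d<m. \<Sum>q<l d. c d q * v d (l d - 1 - q + Q) $ i)"
      by (intro sum.cong) auto
    also have "\<dots> = (\<Sum>x\<in>?X. c (fst x) (snd x) * v (fst x) (l (fst x) - 1 - snd x + Q) $ i)"
      by (subst sum.Sigma) (auto simp only: split_def finite_lessThan)
    finally show ?thesis using shifted[OF i, of Q] by simp
  qed
  from indep[OF this] D show False by auto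
qed

text \<open>Independence of the last vectors spreads to all chain vectors. There are
  \<open>n\<close> of them, so they form a basis, and the matrix \<open>P\<close> of this basis
  conjugates \<open>A\<close> to its Jordan form.\<close>

lemma jordan_nf_of_chains:
  fixes A :: "'a :: field mat" and v :: "nat \<Rightarrow> nat \<Rightarrow> 'a vec" and l :: "nat \<Rightarrow> nat"
  assumes A: "A \<in> carrier_mat n n"
    and v: "\<And>d k. d < m \<Longrightarrow> v d k \<in> carrier_vec n"
    and step: "\<And>d k. d < m \<Longrightarrow> A *\<^sub>v v d k = a \<cdot>\<^sub>v v d k + v d (Suc k)"
    and zero: "\<And>d. d < m \<Longrightarrow> v d (l d) = 0\<^sub>v n"
    and pos: "\<And>d. d < m \<Longrightarrow> 0 < l d"
    and len: "(\<Sum>d<m. l d) = n"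
    and indep: "\<And>c. (\<And>i. i < n \<Longrightarrow> (\<Sum>d<m. c d * v d (l d - 1) $ i) = 0) \<Longrightarrow> \<forall>d<m. c d = 0"
  shows "jordan_nf A (map (\<lambda>d. (l d, a)) [0..<m])"
proof -
  define C where "C d = map (\<lambda>q. v d (l d - 1 - q)) [0..<l d]" for d
  define P where "P = mat_of_cols n (concat (map C [0..<m]))"
  let ?J = "jordan_matrix (map (\<lambda>d. (l d, a)) [0..<m])"
  have lenC: "length (C d) = l d" for d by (simp add: C_def)
  have P: "P \<in> carrier_mat n n"
    unfolding P_def using mat_of_cols_carrier(1)[of n "concat (map C [0..<m])"]
    unfolding length_concat_map_upt[OF lenC] len .
  have J: "?J \<in> carrier_mat n n"
    using jordan_matrix_carrier[of "map (\<lambda>d. (l d, a)) [0..<m]"] len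
    by (simp add: comp_def interv_sum_list_conv_sum_set_nat lessThan_atLeast0)
  have AP: "A * P = P * ?J"
  proof -
    have "A * P = P * jordan_matrix (map (\<lambda>c. (length c, a)) (map C [0..<m]))"
      unfolding P_def
    proof (rule mat_of_cols_concat_jordan_matrix[OF A])
      fix c assume "c \<in> set (map C [0..<m])"
      then obtain d where d: "d < m" "c = C d" by auto
      show "A * mat_of_cols n c = mat_of_cols n c * jordan_block (length c) a"
        unfolding d(2) lenC unfolding C_def
        by (rule mat_of_cols_chain_jordan_block[OF A]) (use d v step zero in auto)
    qed
    then show ?thesis by (simp add: lenC comp_def)
  qed
  have zero': "v d k = 0\<^sub>v n" if "d < m" "l d \<le> k" for d k
    using that(2)
  proof (induction k rule: dec_induct)
    case base
    show ?case using zero that(1) by simp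
  next
    case (step k)
    have "A *\<^sub>v 0\<^sub>v n = a \<cdot>\<^sub>v 0\<^sub>v n + v d (Suc k)"
      using assms(3)[OF that(1), of k] step.IH by simp
    moreover have "A *\<^sub>v 0\<^sub>v n = 0\<^sub>v n" using A by (intro eq_vecI) auto
    moreover have "a \<cdot>\<^sub>v 0\<^sub>v n = 0\<^sub>v n" by (intro eq_vecI) auto
    ultimately show ?case using v[OF that(1), of "Suc k"] by simp
  qed
  have "det P \<noteq> 0"
  proof
    assume "det P = 0"
    then obtain u where u: "u \<in> carrier_vec n" "u \<noteq> 0\<^sub>v n" "P *\<^sub>v u = 0\<^sub>v n"
      using det_0_iff_vec_prod_zero_field[OF P] by blast
    define c where "c d q = u $ ((\<Sum>e<d. l e) + q)" for d q
    have comb: "(\<Sum>d<m. \<Sum>q<l d. c d q * v d (l d - 1 - q) $ i) = 0" if i: "i < n" for i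
    proof -
      have "0 = (P *\<^sub>v u) $ i" using u i by simp
      also have "\<dots> = (\<Sum>j<n. P $$ (i, j) * u $ j)"
        using P u(1) i by (auto simp: scalar_prod_def lessThan_atLeast0 intro!: sum.cong)
      also have "\<dots> = (\<Sum>j<n. u $ j * concat (map C [0..<m]) ! j $ i)"
        using i length_concat_map_upt[OF lenC] len unfolding P_def
        by (intro sum.cong) (simp_all add: mat_of_cols_index del: length_concat)
      also have "\<dots> = (\<Sum>d<m. \<Sum>q<l d. c d q * C d ! q $ i)"
        unfolding len[symmetric] sum_lessThan_sum c_def
        by (intro sum.cong refl) (simp add: nth_concat_map_upt[OF lenC])
      finally show ?thesis by (simp add: C_def)
    qed
    have "c d q = 0" if "d < m" "q < l d" for d q
      by (rule chain_combination_trivial[OF A v step zero' indep comb that])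
    then have "u $ j = 0" if "j < n" for j
      using that unfolding len[symmetric] by (elim less_sum_lessThanE) (auto simp: c_def)
    then have "u = 0\<^sub>v n" using u(1) by (intro eq_vecI) auto
    with u(2) show False by simp
  qed
  then obtain R where R: "R \<in> carrier_mat n n" "P * R = 1\<^sub>m n" "R * P = 1\<^sub>m n"
    using det_non_zero_imp_unit[OF P, of "()"] unfolding Units_def ring_mat_def by auto
  have "A = A * (P * R)" using R A by simp
  also have "\<dots> = P * ?J * R" using assoc_mult_mat[OF A P R(1)] AP by simp
  finally have "similar_mat A ?J"
    using A P R J by (intro similar_matI[of _ _ P R n]) auto
  then show ?thesis using pos unfolding jordan_nf_def by force
qed

section \<open>Kronecker products of unipotent blocks\<close>

lemma kronecker_mult_vec_index:
  fixes A B :: "'a :: comm_semiring_0 mat"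
  assumes A: "A \<in> carrier_mat r r" and B: "B \<in> carrier_mat s s"
    and x: "x \<in> carrier_vec (r * s)" and i: "i < r" and j: "j < s"
  shows "(kronecker_mat A B *\<^sub>v x) $ (i * s + j) =
    (\<Sum>k<r. A $$ (i, k) * (\<Sum>q<s. B $$ (j, q) * x $ (k * s + q)))"
proof -
  have less: "k * s + q < r * s" if "k < r" "q < s" for k q
  proof -
    have "k * s + q < Suc k * s" using that by simp
    also have "\<dots> \<le> r * s" using that by (intro mult_le_mono1) simp
    finally show ?thesis .
  qed
  have "(kronecker_mat A B *\<^sub>v x) $ (i * s + j) =
      (\<Sum>n<r * s. kronecker_mat A B $$ (i * s + j, n) * x $ n)"
    using A B x less[OF i j]
    by (auto simp: kronecker_mat_def scalar_prod_def lessThan_atLeast0 intro!: sum.cong)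
  also have "\<dots> = (\<Sum>k<r. \<Sum>q<s. kronecker_mat A B $$ (i * s + j, k * s + q) * x $ (k * s + q))"
    using sum_lessThan_sum[of _ "\<lambda>_. s" r] by simp
  also have "\<dots> = (\<Sum>k<r. \<Sum>q<s. A $$ (i, k) * (B $$ (j, q) * x $ (k * s + q)))"
    using A B less i j by (intro sum.cong refl) (simp add: kronecker_mat_def mult.assoc)
  finally show ?thesis by (simp add: sum_distrib_left)
qed

lemma sum_unip_jordan_row:
  fixes y :: "nat \<Rightarrow> 'a :: comm_ring_1"
  assumes "i < n"
  shows "(\<Sum>k<n. unip_jordan n $$ (i, k) * y k) = y i + (if Suc i < n then y (Suc i) else 0)"
proof -
  have "(\<Sum>k<n. unip_jordan n $$ (i, k) * y k) =
      (\<Sum>k<n. (if k = i then y k else 0) + (if k = Suc i then y k else 0))"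
    using assms by (intro sum.cong) (auto simp: unip_jordan_def)
  then show ?thesis using assms by (simp add: sum.distrib sum.delta)
qed

text \<open>
  Identify the basis vector \<open>n\<close> of the tensor product with \<open>x\<^sup>i y\<^sup>j\<close>, where \<open>i = r - 1 - n div s\<close>
  and \<open>j = s - 1 - n mod s\<close>. A polynomial \<open>f\<close> of degree at most \<open>e\<close> stands for the form
  \<open>\<Sum>\<^sub>k f\<^sub>k x\<^sup>k y\<^bsup>e-k\<^esup>\<close>; the vector below is its image under \<open>y \<mapsto> (1 + x) y\<close>, which turns
  multiplication by \<open>x + y\<close> into multiplication by \<open>(1 + x)(1 + y) - 1\<close>.
\<close>
definition twisted_coeff :: "nat \<Rightarrow> 'a :: comm_ring_1 poly \<Rightarrow> nat \<Rightarrow> nat \<Rightarrow> 'a" where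
  "twisted_coeff e f i j =
     (if j \<le> e \<and> e \<le> i + j then coeff f (e - j) * of_nat (j choose (i + j - e)) else 0)"

definition twisted_vec :: "nat \<Rightarrow> nat \<Rightarrow> nat \<Rightarrow> 'a :: comm_ring_1 poly \<Rightarrow> 'a vec" where
  "twisted_vec r s e f =
     vec (r * s) (\<lambda>n. twisted_coeff e f (r - 1 - n div s) (s - 1 - n mod s))"

text \<open>Here \<open>twisted_coeff e f i j\<close> is the coefficient of \<open>x^i y^j\<close>
  in the sum of \<open>f_k x^k ((1 + x) y)^(e-k)\<close>. Since
  \<open>x + (1 + x) y = x + y + x y\<close>, the right side has three terms; the identity reduces
  to Pascal's rule.\<close>

lemma twisted_coeff_mult:
  assumes "degree f \<le> e"
  shows "twisted_coeff (Suc e) ([:1, 1:] * f) i j =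
    (if 0 < i then twisted_coeff e f (i - 1) j else 0) +
    (if 0 < j then twisted_coeff e f i (j - 1) else 0) +
    (if 0 < i \<and> 0 < j then twisted_coeff e f (i - 1) (j - 1) else 0)"
proof -
  have c: "coeff ([:1, 1:] * f) k = coeff f k + (if k = 0 then 0 else coeff f (k - 1))" for k
    by (cases k) simp_all
  \<comment> \<open>For \<open>j = 0\<close> the left side could involve this coefficient, which the
    right side never sees.\<close>
  have top: "coeff f (Suc e) = 0" using assms by (simp add: coeff_eq_0)
  show ?thesis
  proof (cases i)
    case 0
    show ?thesis
    proof (cases j)
      case (Suc j')
      then show ?thesis using 0 by (auto simp: twisted_coeff_def c simp del: mult_pCons_left)
    qed (simp add: 0 twisted_coeff_def)
  next
    case (Suc i')
    note i = this
    show ?thesis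
    proof (cases j)
      case 0
      then show ?thesis using i top by (auto simp: twisted_coeff_def c simp del: mult_pCons_left)
    next
      case (Suc j')
      have step: "e - j' = Suc (e - Suc j')" if "Suc j' \<le> e" using that by simp
      show ?thesis
      proof (cases "j' \<le> e \<and> e \<le> i' + j'")
        case True
        then have "Suc i' + Suc j' - Suc e = Suc (i' + j' - e)" "i' + Suc j' - e = Suc (i' + j' - e)"
          "Suc i' + j' - e = Suc (i' + j' - e)" by auto
        then show ?thesis using True step i Suc
          by (auto simp: twisted_coeff_def c algebra_simps simp del: mult_pCons_left)
      next
        case False
        then show ?thesis using i Suc step
          by (auto simp: twisted_coeff_def c algebra_simps simp del: mult_pCons_left)
      qed
    qed
  qed
qed

text \<open>Both indices are reversed because a superdiagonal one lowers the index of a basis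
  vector, whereas multiplication by \<open>x\<close> or \<open>y\<close> raises an exponent.\<close>

lemma twisted_vec_index:
  assumes "i < r" "j < s"
  shows "twisted_vec r s e f $ ((r - 1 - i) * s + (s - 1 - j)) = twisted_coeff e f i j"
    and "(r - 1 - i) * s + (s - 1 - j) < r * s"
proof -
  have "(r - 1 - i) * s + (s - 1 - j) < Suc (r - 1 - i) * s" using assms by simp
  also have "\<dots> \<le> r * s" using assms by (intro mult_le_mono1) simp
  finally show "(r - 1 - i) * s + (s - 1 - j) < r * s" .
  moreover have "((r - 1 - i) * s + (s - 1 - j)) div s = r - 1 - i"
    "((r - 1 - i) * s + (s - 1 - j)) mod s = s - 1 - j"
    using div_mult_self3[of s "r - 1 - i" "s - 1 - j"] mod_mult_self3[of "r - 1 - i" s "s - 1 - j"]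
      assms by (simp_all del: div_mult_self3 mod_mult_self3 Nat.add_diff_assoc)
  ultimately show "twisted_vec r s e f $ ((r - 1 - i) * s + (s - 1 - j)) = twisted_coeff e f i j"
    using assms by (simp add: twisted_vec_def)
qed

lemma less_mult_reversedE:
  assumes "n < r * (s :: nat)"
  obtains i j where "i < r" "j < s" "n = (r - 1 - i) * s + (s - 1 - j)"
proof
  have s: "0 < s" using assms by (cases s) auto
  have d: "n div s < r" using assms by (simp add: less_mult_imp_div_less)
  show "r - 1 - n div s < r" "s - 1 - n mod s < s" using s d by auto
  have "r - 1 - (r - 1 - n div s) = n div s" "s - 1 - (s - 1 - n mod s) = n mod s"
    using d s mod_less_divisor[of s n] by linarith+
  then show "n = (r - 1 - (r - 1 - n div s)) * s + (s - 1 - (s - 1 - n mod s))" by simp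
qed

lemma kronecker_unip_jordan_carrier:
  "kronecker_mat (unip_jordan r) (unip_jordan s :: 'a :: comm_ring_1 mat) \<in> carrier_mat (r * s) (r * s)"
  by (simp add: kronecker_mat_def unip_jordan_def)

text \<open>The two factors act as multiplication by \<open>1 + x\<close> and \<open>1 + y\<close>.
  Subtracting the identity leaves \<open>x + y + x y\<close>, which is the twist of
  \<open>x + y\<close>, or \<open>1 + X\<close> after setting \<open>y = 1\<close>.\<close>

lemma kronecker_mult_twisted_vec:
  fixes f :: "'a :: comm_ring_1 poly"
  assumes "degree f \<le> e"
  shows "kronecker_mat (unip_jordan r) (unip_jordan s) *\<^sub>v twisted_vec r s e f =
    twisted_vec r s e f + twisted_vec r s (Suc e) ([:1, 1:] * f)" (is "?K *\<^sub>v ?x = ?x + ?y")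
proof (rule eq_vecI)
  fix n assume "n < dim_vec (?x + ?y)"
  then have "n < r * s" by (simp add: twisted_vec_def)
  then obtain i j where ij: "i < r" "j < s" and n: "n = (r - 1 - i) * s + (s - 1 - j)"
    by (elim less_mult_reversedE)
  have x: "?x \<in> carrier_vec (r * s)" by (simp add: twisted_vec_def)
  have U: "unip_jordan r \<in> carrier_mat r r" "unip_jordan s \<in> carrier_mat s s"
    by (auto simp: unip_jordan_def)
  have ri: "r - 1 - i < r" "s - 1 - j < s" using ij by auto
  have down_i: "Suc (r - 1 - i) = r - 1 - (i - 1)" if "0 < i" using that ij by auto
  have down_j: "Suc (s - 1 - j) = s - 1 - (j - 1)" if "0 < j" using that ij by auto
  define X where "X i = twisted_coeff e f i j +
    (if 0 < j then twisted_coeff e f i (j - 1) else 0)" for i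
  have inner: "(\<Sum>q<s. unip_jordan s $$ (s - 1 - j, q) * ?x $ ((r - 1 - k) * s + q)) = X k"
    if "k < r" for k
  proof -
    have "Suc (s - 1 - j) < s \<longleftrightarrow> 0 < j" using ij by auto
    moreover have "?x $ ((r - 1 - k) * s + Suc (s - 1 - j)) = twisted_coeff e f k (j - 1)"
      if "0 < j" unfolding down_j[OF that]
      by (rule twisted_vec_index) (use ij \<open>k < r\<close> in auto)
    ultimately show ?thesis
      unfolding sum_unip_jordan_row[OF ri(2)] twisted_vec_index(1)[OF that ij(2)] X_def by simp
  qed
  have "(?K *\<^sub>v ?x) $ n = (\<Sum>k<r. unip_jordan r $$ (r - 1 - i, k) *
      (\<Sum>q<s. unip_jordan s $$ (s - 1 - j, q) * ?x $ (k * s + q)))"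
    unfolding n by (rule kronecker_mult_vec_index[OF U x ri])
  also have "\<dots> = X i + (if 0 < i then X (i - 1) else 0)"
  proof -
    have "Suc (r - 1 - i) < r \<longleftrightarrow> 0 < i" using ij by auto
    moreover have "(\<Sum>q<s. unip_jordan s $$ (s - 1 - j, q) * ?x $ (Suc (r - 1 - i) * s + q)) = X (i - 1)"
      if "0 < i" unfolding down_i[OF that] by (rule inner) (use ij in auto)
    ultimately show ?thesis
      unfolding sum_unip_jordan_row[OF ri(1)] inner[OF ij(1)] by simp
  qed
  also have "\<dots> = twisted_coeff e f i j + twisted_coeff (Suc e) ([:1, 1:] * f) i j"
    unfolding twisted_coeff_mult[OF assms] X_def by simp
  also have "\<dots> = ?x $ n + ?y $ n" unfolding n twisted_vec_index(1)[OF ij] by simp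
  also have "\<dots> = (?x + ?y) $ n" using \<open>n < r * s\<close> by (simp add: twisted_vec_def)
  finally show "(?K *\<^sub>v ?x) $ n = (?x + ?y) $ n" .
qed (simp add: twisted_vec_def kronecker_mat_def unip_jordan_def)

section \<open>Lengths of the chains and their last vectors\<close>

lemma degree_one_plus_X_power_mult_le:
  fixes f :: "'a :: field poly"
  assumes "degree f \<le> d"
  shows "degree ([:1, 1:] ^ k * f) \<le> d + k"
proof -
  have "degree ([:1, 1:] ^ k * f) \<le> degree ([:1, 1 :: 'a:] ^ k) + degree f" by (rule degree_mult_le)
  also have "degree ([:1, 1 :: 'a:] ^ k) \<le> k" by (simp add: degree_power_eq)
  finally show ?thesis using assms by simp
qed

text \<open>Modulo \<open>x^r\<close> and \<open>y^s\<close>, a monomial \<open>x^k y^(e-k)\<close>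
  survives only if \<open>k < r\<close> and \<open>e - k < s\<close>.\<close>

lemma twisted_vec_eq_0:
  assumes "\<And>k. k < r \<Longrightarrow> e < k + s \<Longrightarrow> coeff f k = 0"
  shows "twisted_vec r s e f = 0\<^sub>v (r * s)"
proof (rule eq_vecI)
  fix n assume "n < dim_vec (0\<^sub>v (r * s) :: 'a vec)"
  then have "n < r * s" by simp
  then obtain i j where ij: "i < r" "j < s" and n: "n = (r - 1 - i) * s + (s - 1 - j)"
    by (elim less_mult_reversedE)
  have "twisted_coeff e f i j = 0" using ij assms[of "e - j"] by (auto simp: twisted_coeff_def)
  then show "twisted_vec r s e f $ n = 0\<^sub>v (r * s) $ n"
    unfolding n twisted_vec_index(1)[OF ij] using twisted_vec_index(2)[OF ij] by simp
qed (simp add: twisted_vec_def)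

text \<open>The partial sums make the induction work; at \<open>k = r\<close> the value is
  \<open>r * s\<close>, the size of the matrix.\<close>

lemma chain_length_sum:
  assumes "k \<le> r" "r \<le> (s :: nat)"
  shows "(\<Sum>d<k. r + s - 1 - 2 * d) = k * (r + s - k)"
  using assms(1)
proof (induction k)
  case (Suc k)
  define t where "t = r + s - Suc k - k"
  have "r + s - 1 - 2 * k = t" "r + s - k = t + k + 1" "r + s - Suc k = t + k"
    using Suc.prems assms(2) by (auto simp: t_def)
  then show ?case using Suc by (simp add: algebra_simps)
qed simp

text \<open>The window holds the \<open>d + 1\<close> coefficients that survive in degree
  \<open>r + s - 2 - d\<close>. If all vanished, the gap would be long enough to force a forbidden
  congruence for \<open>s\<close>.\<close>

lemma top_coeff_nonzero:
  fixes f :: "'a :: field poly"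
  assumes f: "f \<noteq> 0" "degree f \<le> d" and d: "d < r" "r \<le> s"
    and s0: "\<not> [int s = 0] (mod int CHAR('a))"
    and sj: "\<forall>j::int. 1 \<le> j \<and> j \<le> int r - 2 \<longrightarrow>
           \<not> [int s = j] (mod int CHAR('a)) \<and> \<not> [int s = - j] (mod int CHAR('a))"
  shows "\<exists>k<r. r \<le> k + d + 1 \<and> coeff ([:1, 1:] ^ (r + s - 2 - 2 * d) * f) k \<noteq> 0"
proof (rule ccontr)
  let ?h = "r + s - 2 - 2 * d"
  assume "\<not> ?thesis"
  then have gap: "coeff ([:1, 1:] ^ ?h * f) k = 0" if "k < r" "r \<le> k + d + 1" for k
    using that by blast
  show False
  proof (cases "Suc d = r")
    \<comment> \<open>Here the window consists of all degrees below \<open>r\<close>, leaving no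
      room for a low-degree part.\<close>
    case True
    then have "monom 1 r dvd [:1, 1:] ^ ?h * f"
      using gap unfolding monom_1_dvd_iff' by auto
    then have "monom 1 r dvd f" by (rule monom_dvd_shift_cancel)
    then show False using f d dvd_imp_degree_le[of "monom (1::'a) r" f]
      by (simp add: degree_monom_eq)
  next
    case False
    define m where "m = r - 2 - d"
    have m: "m + d + 2 = r" using False d by (simp add: m_def)
    have "\<exists>a b. a \<le> m \<and> b \<le> d \<and> (of_nat (?h + b) :: 'a) = of_nat a"
      by (rule coeff_gap_imp_char_relation[OF f]) (use gap m in auto)
    then obtain a b where ab: "a \<le> m" "b \<le> d" "(of_nat (?h + b) :: 'a) = of_nat a" by blast
    \<comment> \<open>As \<open>r = m + d + 2\<close>, the exponent satisfies
      \<open>?h + b - a = s + t\<close>. Since \<open>m - a\<close> lies between 0 and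
      \<open>m\<close>, and \<open>d - b\<close> between 0 and \<open>d\<close>, the absolute value
      of \<open>t\<close> is at most \<open>m + d = r - 2\<close>.\<close>
    define t where "t = int m - int a - (int d - int b)"
    have "int (?h + b) - int a = int s + t" using m d by (simp add: t_def of_nat_diff)
    moreover have "(of_int (int (?h + b) - int a) :: 'a) = 0" using ab(3) by simp
    ultimately have "(of_int (int s + t) :: 'a) = 0" by metis
    then have dvd: "int CHAR('a) dvd int s + t" by (simp only: of_int_eq_0_iff_char_dvd)
    then have "[int s = - t] (mod int CHAR('a))" by (simp add: cong_iff_dvd_diff)
    moreover have "\<bar>t\<bar> \<le> int r - 2" using ab m by (auto simp: t_def)
    ultimately show False using s0 sj[rule_format, of "\<bar>t\<bar>"]
      by (cases t "0 :: int" rule: linorder_cases) auto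
  qed
qed

theorem theorem2:
  fixes p r s :: nat
  assumes "prime p"
    and "CHAR('a :: field) = p"
    and "1 \<le> r" and "r \<le> s"
    and "\<not> [int s = 0] (mod int p)"
    and "\<forall>j::int. 1 \<le> j \<and> j \<le> int r - 2 \<longrightarrow>
           \<not> [int s = j] (mod int p) \<and> \<not> [int s = - j] (mod int p)"
  shows "jordan_nf (kronecker_mat (unip_jordan r :: 'a mat) (unip_jordan s))
           (map (\<lambda>i. (r + s + 1 - 2 * i, 1)) [1..<r+1])"
proof -
  define l where "l d = r + s - 1 - 2 * d" for d
  \<comment> \<open>For \<open>d < r\<close> these are exactly the \<open>d\<close> coefficients
    that survive in degree \<open>d + l d = r + s - 1 - d\<close>, so the chain dies after
    \<open>l d\<close> steps.\<close>
  have "\<exists>f :: 'a poly. f \<noteq> 0 \<and> degree f \<le> d \<and>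
      (\<forall>k. r - 1 - d < k \<and> k \<le> r - 1 - d + d \<longrightarrow> coeff ([:1, 1:] ^ l d * f) k = 0)" for d
    by (rule nonzero_poly_with_coeff_gap)
  then obtain f :: "nat \<Rightarrow> 'a poly" where f: "\<And>d. f d \<noteq> 0" "\<And>d. degree (f d) \<le> d"
    and gap: "\<And>d k. r - 1 - d < k \<Longrightarrow> k \<le> r - 1 - d + d \<Longrightarrow> coeff ([:1, 1:] ^ l d * f d) k = 0"
    by metis
  define v where "v d k = twisted_vec r s (d + k) ([:1, 1:] ^ k * f d)" for d k
  have "jordan_nf (kronecker_mat (unip_jordan r :: 'a mat) (unip_jordan s))
      (map (\<lambda>d. (l d, 1)) [0..<r])"
  proof (rule jordan_nf_of_chains[OF kronecker_unip_jordan_carrier])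
    show "v d k \<in> carrier_vec (r * s)" for d k by (simp add: v_def twisted_vec_def)
    show "kronecker_mat (unip_jordan r) (unip_jordan s) *\<^sub>v v d k = 1 \<cdot>\<^sub>v v d k + v d (Suc k)" for d k
      using kronecker_mult_twisted_vec[OF degree_one_plus_X_power_mult_le[OF f(2)[of d], of k], of r s]
      by (simp add: v_def mult.assoc del: mult_pCons_left)
    show "v d (l d) = 0\<^sub>v (r * s)" if "d < r" for d
      unfolding v_def by (rule twisted_vec_eq_0, rule gap) (use that assms(4) in \<open>auto simp: l_def\<close>)
    show "0 < l d" if "d < r" for d using that assms(4) by (simp add: l_def)
    show "(\<Sum>d<r. l d) = r * s" unfolding l_def using chain_length_sum[of r r s] assms(4) by simp
  next
    fix c :: "nat \<Rightarrow> 'a"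
    assume comb: "\<And>i. i < r * s \<Longrightarrow> (\<Sum>d<r. c d * v d (l d - 1) $ i) = 0"
    show "\<forall>d<r. c d = 0"
    proof (rule ccontr)
      assume "\<not> ?thesis"
      then have "\<exists>d. d < r \<and> c d \<noteq> 0" by blast
      \<comment> \<open>The last vector of chain \<open>d\<close> starts in degree
        \<open>r + s - 2 - d\<close>, and the twist adds only higher degrees. The largest
        \<open>D\<close> thus gives the lowest degree in the relation.\<close>
      then obtain D where D: "D < r" "c D \<noteq> 0" and max: "\<And>d. d < r \<Longrightarrow> c d \<noteq> 0 \<Longrightarrow> d \<le> D"
        using Nat.ex_has_greatest_nat[where P = "\<lambda>d. d < r \<and> c d \<noteq> 0" and b = r] by (metis less_imp_le)
      have lD: "l d - 1 = r + s - 2 - 2 * d" for d by (simp add: l_def)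
      obtain i where i: "i < r" "r \<le> i + D + 1"
        and ci: "coeff ([:1, 1:] ^ (l D - 1) * f D) i \<noteq> 0"
        using top_coeff_nonzero[OF f(1) f(2) D(1) assms(4)] assms(2,5,6) unfolding lD by blast
      define j where "j = r + s - 2 - D - i"
      have j: "j < s" "i + j + D + 2 = r + s" using i D assms(4) by (auto simp: j_def)
      let ?n = "(r - 1 - i) * s + (s - 1 - j)"
      \<comment> \<open>The monomial \<open>x^i y^j\<close> has degree \<open>r + s - 2 - D\<close>.
        Chains with \<open>d < D\<close> start above it, and for \<open>d = D\<close> the binomial
        factor is \<open>j choose 0\<close>.\<close>
      have entry: "c d * v d (l d - 1) $ ?n =
          (if d = D then c D * coeff ([:1, 1:] ^ (l D - 1) * f D) i else 0)"
        if "d < r" for d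
      proof (cases "c d = 0")
        case False
        then have "d \<le> D" using max that by blast
        have "d + (l d - 1) = i + j + (D - d)"
          using j(2) D(1) \<open>d \<le> D\<close> assms(4) by (simp add: l_def)
        then show ?thesis unfolding v_def twisted_vec_index(1)[OF i(1) j(1)]
          using \<open>d \<le> D\<close> by (auto simp: twisted_coeff_def)
      qed (use D in auto)
      have "(\<Sum>d<r. c d * v d (l d - 1) $ ?n) = c D * coeff ([:1, 1:] ^ (l D - 1) * f D) i"
        using D(1) by (subst sum.cong[OF refl entry]) (simp_all add: sum.delta)
      then show False using comb[OF twisted_vec_index(2)[OF i(1) j(1)]] D ci by simp
    qed
  qed
  also have "map (\<lambda>d. (l d, 1)) [0..<r] = map (\<lambda>i. (r + s + 1 - 2 * i, 1 :: 'a)) [1..<r+1]"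
    by (rule nth_equalityI) (auto simp: l_def nth_append simp del: upt_Suc)
  finally show ?thesis .
qed

end
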